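(* Let $(X,d)$ be a $T_1$ quasi-metric space and let $X'$ denote the set of non-isolated points of $(X,d)$. If $(X,d)$ is normal, then the following assertions are equivalent: (a) $(X,d)$ is a UC space; (b) if $A$ is a subset of $X$ without an accumulation point in $(X,d)$, then $A\cap X'$ is finite and $\inf\{I^{+}(x):x\in A\setminus X'\}>0$; (c) whenever $(x_n)$ is a sequence in $X$ without a cluster point in $(X,d)$ and $B=\{n\in\mathbb{N}: x_n \text{ is not an isolated point of } (X,d)\}$, then $B$ is finite and $\inf\{I^{+}(x_n):n\notin B\}>0$; (d) for any quasi-metric space $(M,\rho)$ with the property that forward convergence implies backward convergence, every forward continuous function $f:(X,d)\to(M,\rho)$ is forward uniformly continuous.
   Context: A quasi-metric on a set $X$ is a function $d:X\times X\to\mathbb{R}$ with, for all $x,y,z\in X$: $d(x,y)\ge 0$ and $d(x,x)=0$; $d(x,y)=0=d(y,x)$ implies $x=y$; and $d(x,y)\le d(x,z)+d(z,y)$ (symmetry is not required). The forward topology $\tau(d)$ is generated by the forward balls $B^{+}(x,\epsilon)=\{y\in X: d(x,y)<\epsilon\}$. All topological notions for $(X,d)$ ($T_1$, normal, isolated point, accumulation point, etc.) refer to $\tau(d)$; normal means that disjoint closed sets can be separated by disjoint open sets ($T_1$ is assumed separately). A sequence $(x_n)$ is forward convergent to $x$ if $d(x,x_n)\to 0$, and backward convergent to $x$ if $d(x_n,x)\to 0$. "Forward convergence implies backward convergence" means: whenever a sequence is forward convergent to a point, it is also backward convergent to that point. A point $x$ is a cluster point of $(x_n)$ in $(X,d)$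 if some subsequence of $(x_n)$ is forward convergent to $x$. A function $f:(X,d)\to(M,\rho)$ between quasi-metric spaces is forward continuous if it is continuous from $\tau(d)$ to $\tau(\rho)$, i.e. for each $x_0\in X$ and $\epsilon>0$ there is $\delta>0$ such that $d(x_0,y)<\delta$ implies $\rho(f(x_0),f(y))<\epsilon$; it is forward uniformly continuous if for every $\epsilon>0$ there is $\delta>0$ such that $d(x,y)<\delta$ implies $\rho(f(x),f(y))<\epsilon$. When the target is $(\mathbb{R},|\cdot|)$ this is called uniformly continuous. $(X,d)$ is a UC space if every forward continuous $f:(X,d)\to(\mathbb{R},|\cdot|)$ is uniformly continuous. The isolation functional is $I^{+}(x)=\inf\{d(x,y): y\in X\setminus\{x\}\}$ for $x\in X$. Infima over the empty set are $+\infty$. *)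

theory Defs
  imports "HOL-Analysis.Analysis"
begin

locale quasi_metric_space =
  fixes X :: "'a set" and d :: "'a \<Rightarrow> 'a \<Rightarrow> real"
  assumes nonneg: "\<lbrakk>x \<in> X; y \<in> X\<rbrakk> \<Longrightarrow> 0 \<le> d x y"
    and refl_zero: "x \<in> X \<Longrightarrow> d x x = 0"
    and separated: "\<lbrakk>x \<in> X; y \<in> X; d x y = 0; d y x = 0\<rbrakk> \<Longrightarrow> x = y"
    and triangle: "\<lbrakk>x \<in> X; y \<in> X; z \<in> X\<rbrakk> \<Longrightarrow> d x y \<le> d x z + d z y"

definition forward_ball :: "'a set \<Rightarrow> ('a \<Rightarrow> 'a \<Rightarrow> real) \<Rightarrow> 'a \<Rightarrow> real \<Rightarrow> 'a set" where
  "forward_ball X d x \<epsilon> = {y \<in> X. d x y < \<epsilon>}"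

definition forward_topology :: "'a set \<Rightarrow> ('a \<Rightarrow> 'a \<Rightarrow> real) \<Rightarrow> 'a topology" where
  "forward_topology X d = topology_generated_by {forward_ball X d x \<epsilon> | x \<epsilon>. x \<in> X \<and> \<epsilon> > 0}"

definition forward_convergent ::
    "'a set \<Rightarrow> ('a \<Rightarrow> 'a \<Rightarrow> real) \<Rightarrow> (nat \<Rightarrow> 'a) \<Rightarrow> 'a \<Rightarrow> bool" where
  "forward_convergent X d s x \<longleftrightarrow> range s \<subseteq> X \<and> x \<in> X \<and> (\<lambda>n. d x (s n)) \<longlonglongrightarrow> 0"

definition backward_convergent ::
    "'a set \<Rightarrow> ('a \<Rightarrow> 'a \<Rightarrow> real) \<Rightarrow> (nat \<Rightarrow> 'a) \<Rightarrow> 'a \<Rightarrow> bool" where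
  "backward_convergent X d s x \<longleftrightarrow> range s \<subseteq> X \<and> x \<in> X \<and> (\<lambda>n. d (s n) x) \<longlonglongrightarrow> 0"

definition forward_imp_backward :: "'a set \<Rightarrow> ('a \<Rightarrow> 'a \<Rightarrow> real) \<Rightarrow> bool" where
  "forward_imp_backward X d \<longleftrightarrow>
     (\<forall>s x. forward_convergent X d s x \<longrightarrow> backward_convergent X d s x)"

definition cluster_point ::
    "'a set \<Rightarrow> ('a \<Rightarrow> 'a \<Rightarrow> real) \<Rightarrow> (nat \<Rightarrow> 'a) \<Rightarrow> 'a \<Rightarrow> bool" where
  "cluster_point X d s x \<longleftrightarrow> (\<exists>r::nat \<Rightarrow> nat. strict_mono r \<and> forward_convergent X d (s \<circ> r) x)"

definition forward_continuous ::
    "'a set \<Rightarrow> ('a \<Rightarrow> 'a \<Rightarrow> real) \<Rightarrow> 'b set \<Rightarrow> ('b \<Rightarrow> 'b \<Rightarrow> real) \<Rightarrow> ('a \<Rightarrow> 'b) \<Rightarrow> bool" where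
  "forward_continuous X d M \<rho> f \<longleftrightarrow>
     continuous_map (forward_topology X d) (forward_topology M \<rho>) f"

definition forward_uniformly_continuous ::
    "'a set \<Rightarrow> ('a \<Rightarrow> 'a \<Rightarrow> real) \<Rightarrow> 'b set \<Rightarrow> ('b \<Rightarrow> 'b \<Rightarrow> real) \<Rightarrow> ('a \<Rightarrow> 'b) \<Rightarrow> bool" where
  "forward_uniformly_continuous X d M \<rho> f \<longleftrightarrow>
     f ` X \<subseteq> M \<and>
     (\<forall>\<epsilon>>0. \<exists>\<delta>>0. \<forall>x\<in>X. \<forall>y\<in>X. d x y < \<delta> \<longrightarrow> \<rho> (f x) (f y) < \<epsilon>)"

definition UC_space :: "'a set \<Rightarrow> ('a \<Rightarrow> 'a \<Rightarrow> real) \<Rightarrow> bool" where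
  "UC_space X d \<longleftrightarrow>
     (\<forall>f :: 'a \<Rightarrow> real. forward_continuous X d UNIV (\<lambda>s t. \<bar>s - t\<bar>) f \<longrightarrow>
        forward_uniformly_continuous X d UNIV (\<lambda>s t. \<bar>s - t\<bar>) f)"

definition isolated_points :: "'a set \<Rightarrow> ('a \<Rightarrow> 'a \<Rightarrow> real) \<Rightarrow> 'a set" where
  "isolated_points X d = {x \<in> X. openin (forward_topology X d) {x}}"

definition nonisolated_points :: "'a set \<Rightarrow> ('a \<Rightarrow> 'a \<Rightarrow> real) \<Rightarrow> 'a set" where
  "nonisolated_points X d = X - isolated_points X d"

text \<open>Valued in the extended reals, so that the infimum over the empty set is \<open>\<infinity>\<close>.\<close>

definition isolation :: "'a set \<Rightarrow> ('a \<Rightarrow> 'a \<Rightarrow> real) \<Rightarrow> 'a \<Rightarrow> ereal" where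
  "isolation X d x = (INF y \<in> X - {x}. ereal (d x y))"

text \<open>The target spaces \<open>(M, \<rho>)\<close> are those whose points come from the type \<open>'m\<close>: HOL cannot
  quantify over types inside a formula.  A statement about all quasi-metric targets is therefore
  expressed with \<open>'m\<close> a free type variable, together with the instance \<open>real\<close>: a small \<open>'m\<close>
  alone would carry too few targets for the condition to be sufficient.\<close>

definition forward_continuous_imp_uniform ::
    "'a set \<Rightarrow> ('a \<Rightarrow> 'a \<Rightarrow> real) \<Rightarrow> 'm itself \<Rightarrow> bool" where
  "forward_continuous_imp_uniform X d (_ :: 'm itself) \<longleftrightarrow>
     (\<forall>(M :: 'm set) \<rho>. quasi_metric_space M \<rho> \<longrightarrow> forward_imp_backward M \<rho> \<longrightarrow>
        (\<forall>f. forward_continuous X d M \<rho> f \<longrightarrow> forward_uniformly_continuous X d M \<rho> f))"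

context quasi_metric_space
begin

lemma topspace_forward_topology: "topspace (forward_topology X d) = X"
proof -
  have "x \<in> forward_ball X d x 1" if "x \<in> X" for x
    using that by (simp add: forward_ball_def refl_zero)
  then show ?thesis
    unfolding forward_topology_def topology_generated_by_topspace
    by (intro subset_antisym subsetI)
      (auto simp: forward_ball_def, metis (mono_tags, lifting) mem_Collect_eq zero_less_one)
qed

lemma openin_forward_topology_iff:
  "openin (forward_topology X d) U \<longleftrightarrow>
     U \<subseteq> X \<and> (\<forall>x\<in>U. \<exists>\<epsilon>>0. forward_ball X d x \<epsilon> \<subseteq> U)" (is "?L \<longleftrightarrow> ?R")
proof
  assume ?L
  then have "generate_topology_on {forward_ball X d x \<epsilon> | x \<epsilon>. x \<in> X \<and> \<epsilon> > 0} U"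
    by (simp add: forward_topology_def openin_topology_generated_by)
  then show ?R
  proof (induction rule: generate_topology_on.induct)
    case Empty
    show ?case by simp
  next
    case (Int a b)
    show ?case
    proof (intro conjI ballI)
      show "a \<inter> b \<subseteq> X" using Int by blast
      fix x assume "x \<in> a \<inter> b"
      then obtain e1 e2 where "e1 > 0" "forward_ball X d x e1 \<subseteq> a" "e2 > 0" "forward_ball X d x e2 \<subseteq> b"
        using Int by (meson IntD1 IntD2)
      then show "\<exists>\<epsilon>>0. forward_ball X d x \<epsilon> \<subseteq> a \<inter> b"
        by (intro exI[of _ "min e1 e2"]) (auto simp: forward_ball_def)
    qed
  next
    case (UN K)
    then show ?case by (meson Sup_least Sup_upper UnionE order_trans)
  next
    case (Basis s)
    then obtain x \<epsilon> where s: "s = forward_ball X d x \<epsilon>" "x \<in> X" "\<epsilon> > 0" by blast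
    have "forward_ball X d y (\<epsilon> - d x y) \<subseteq> s" "\<epsilon> - d x y > 0" if "y \<in> s" for y
      using that s triangle[of x _ y] by (fastforce simp: forward_ball_def)+
    moreover have "s \<subseteq> X" using s by (auto simp: forward_ball_def)
    ultimately show ?case by blast
  qed
next
  assume R: ?R
  have op: "openin (forward_topology X d) (forward_ball X d x \<epsilon>)" if "x \<in> X" "\<epsilon> > 0" for x \<epsilon>
    unfolding forward_topology_def using that by (intro topology_generated_by_Basis) blast
  show ?L
  proof (subst openin_subopen, intro ballI)
    fix x assume x: "x \<in> U"
    with R obtain \<epsilon> where "\<epsilon> > 0" "forward_ball X d x \<epsilon> \<subseteq> U" by blast
    moreover have "x \<in> forward_ball X d x \<epsilon>"
      using x R \<open>\<epsilon> > 0\<close> by (auto simp: forward_ball_def refl_zero)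
    ultimately show "\<exists>T. openin (forward_topology X d) T \<and> x \<in> T \<and> T \<subseteq> U"
      using op x R by blast
  qed
qed

end

end

(* (a) implies (b): a closed discrete set of isolated points is clopen, so an injective
   integer-valued function on it extends by 0 and breaks uniform continuity as soon as the isolation
   values tend to 0.  If infinitely many points a n of A are non-isolated, Tietze gives a continuous
   g with g (a n) = n, and choosing b n near a n both for d and for g keeps the a n and b n
   together closed and discrete; this is where the asymmetry of d is overcome, since d-closeness
   alone would not prevent the b n from accumulating.  Tietze then separates all the a n from all
   the b n.

   (c) implies (d): take d (x n) (y n) tending to 0 with images far apart.  Along a subsequence
   of x n converging to z, both x n and y n converge to z, and "forward implies backward" in the
   target makes the images close; without a cluster point, isolation bounds d (x n) (y n) below. *)
theory Submission
  imports Defs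
begin

section \<open>Balls, isolation, cluster points and images of convergent sequences\<close>

lemma t1_space_derived_set_of_infinite_Int:
  assumes "t1_space \<tau>" "x \<in> \<tau> derived_set_of S" "openin \<tau> U" "x \<in> U"
  shows "infinite (S \<inter> U)"
  using assms unfolding t1_space_derived_set_of_infinite_openin by blast

context quasi_metric_space
begin

lemma openin_forward_ball:
  assumes "x \<in> X" "\<epsilon> > 0"
  shows "openin (forward_topology X d) (forward_ball X d x \<epsilon>)"
  unfolding forward_topology_def using assms by (intro topology_generated_by_Basis) blast

lemma centre_in_forward_ball: "x \<in> X \<Longrightarrow> \<epsilon> > 0 \<Longrightarrow> x \<in> forward_ball X d x \<epsilon>"
  by (simp add: forward_ball_def refl_zero)

lemma isolation_less_iff:
  "isolation X d x < ereal e \<longleftrightarrow> (\<exists>y\<in>X - {x}. d x y < e)"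
  by (simp add: isolation_def INF_less_iff)

lemma nonisolatedE:
  assumes "x \<in> nonisolated_points X d" "openin (forward_topology X d) U" "x \<in> U"
  obtains y where "y \<in> U" "y \<noteq> x"
proof -
  have "U \<noteq> {x}"
    using assms openin_subset[OF assms(2)]
    by (auto simp: nonisolated_points_def isolated_points_def topspace_forward_topology)
  with assms(3) that show thesis by blast
qed

text \<open>An infinite set of indices is unbounded, so past every index some term lies within
  \<open>1/(n+1)\<close> of \<open>x\<close>; dependent choice makes these indices strictly
  increasing. Counting indices rather than values also covers a value that repeats infinitely
  often.\<close>

lemma cluster_pointI:
  assumes "range s \<subseteq> X" "x \<in> X" and inf: "\<And>e. e > 0 \<Longrightarrow> infinite {n. d x (s n) < e}"
  shows "cluster_point X d s x"
proof -
  have ex: "\<exists>k>m. d x (s k) < inverse (real (Suc n))" for m n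
    using inf[of "inverse (real (Suc n))"] unfolding infinite_nat_iff_unbounded by auto
  have "\<exists>r. \<forall>n. d x (s (r n)) < inverse (real (Suc n)) \<and> r n < r (Suc n)"
    by (rule dependent_nat_choice) (use ex in blast)+
  then obtain r where r: "\<And>n. d x (s (r n)) < inverse (real (Suc n))" "\<And>n. r n < r (Suc n)"
    by blast
  have "(\<lambda>n. d x ((s \<circ> r) n)) \<longlonglongrightarrow> 0"
  proof (rule tendsto_sandwich[OF _ _ tendsto_const LIMSEQ_inverse_real_of_nat])
    show "\<forall>\<^sub>F n in sequentially. 0 \<le> d x ((s \<circ> r) n)"
      using assms by (intro always_eventually allI nonneg) auto
    show "\<forall>\<^sub>F n in sequentially. d x ((s \<circ> r) n) \<le> inverse (real (Suc n))"
      using r(1) by (intro always_eventually allI) (simp add: less_imp_le)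
  qed
  then have "forward_convergent X d (s \<circ> r) x"
    using assms by (auto simp: forward_convergent_def)
  moreover have "strict_mono r"
    using r(2) by (simp add: strict_mono_Suc_iff)
  ultimately show ?thesis
    unfolding cluster_point_def by blast
qed

text \<open>By T1, each ball around an accumulation point of the range contains infinitely many
  values, hence infinitely many terms, which makes it a cluster point. The converse fails for
  constant sequences, so repeated values need separate care on the way to (c).\<close>

lemma derived_set_of_range_empty:
  assumes t1: "t1_space (forward_topology X d)"
    and s: "range s \<subseteq> X" and no: "\<nexists>x. cluster_point X d s x"
  shows "forward_topology X d derived_set_of range s = {}"
proof (rule equals0I)
  fix x assume x: "x \<in> forward_topology X d derived_set_of range s"
  then have xX: "x \<in> X"
    by (simp add: in_derived_set_of topspace_forward_topology)
  have "infinite {n. d x (s n) < e}" if "e > 0" for e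
  proof
    assume "finite {n. d x (s n) < e}"
    then have "finite (s ` {n. d x (s n) < e})" by blast
    moreover have "range s \<inter> forward_ball X d x e \<subseteq> s ` {n. d x (s n) < e}"
      by (auto simp: forward_ball_def)
    ultimately have "finite (range s \<inter> forward_ball X d x e)"
      by (rule finite_subset[rotated])
    then show False
      using t1_space_derived_set_of_infinite_Int[OF t1 x openin_forward_ball[OF xX that]]
        centre_in_forward_ball[OF xX that] by blast
  qed
  then show False
    using cluster_pointI[OF s xX] no by blast
qed

text \<open>Continuity is given by open sets, convergence by distances; a forward ball inside the
  preimage of a forward ball translates between them.\<close>

lemma forward_convergent_image:
  assumes M: "quasi_metric_space M \<rho>" and f: "forward_continuous X d M \<rho> f"
    and s: "forward_convergent X d s x"
  shows "forward_convergent M \<rho> (f \<circ> s) (f x)"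
proof -
  interpret M: quasi_metric_space M \<rho> by (fact M)
  have cf: "continuous_map (forward_topology X d) (forward_topology M \<rho>) f"
    using f by (simp add: forward_continuous_def)
  have fX: "\<And>y. y \<in> X \<Longrightarrow> f y \<in> M"
    using continuous_map_funspace[OF cf]
    by (auto simp: topspace_forward_topology M.topspace_forward_topology)
  have x: "x \<in> X" and sX: "\<And>n. s n \<in> X" and lim: "(\<lambda>n. d x (s n)) \<longlonglongrightarrow> 0"
    using s by (auto simp: forward_convergent_def)
  have "(\<lambda>n. \<rho> (f x) (f (s n))) \<longlonglongrightarrow> 0"
  proof (rule LIMSEQ_I)
    fix e :: real assume e: "0 < e"
    let ?U = "{y \<in> topspace (forward_topology X d). f y \<in> forward_ball M \<rho> (f x) e}"
    have "openin (forward_topology X d) ?U"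
      using cf M.openin_forward_ball[OF fX[OF x] e] by (rule openin_continuous_map_preimage)
    moreover have "x \<in> ?U"
      using x e fX M.centre_in_forward_ball by (simp add: topspace_forward_topology)
    ultimately obtain \<delta> where \<delta>: "\<delta> > 0" "forward_ball X d x \<delta> \<subseteq> ?U"
      unfolding openin_forward_topology_iff by blast
    obtain N where "\<And>n. n \<ge> N \<Longrightarrow> d x (s n) < \<delta>"
      using LIMSEQ_D[OF lim \<delta>(1)] by fastforce
    then have "\<And>n. n \<ge> N \<Longrightarrow> \<rho> (f x) (f (s n)) < e"
      using \<delta>(2) sX by (auto simp: forward_ball_def)
    then show "\<exists>N. \<forall>n\<ge>N. norm (\<rho> (f x) (f (s n)) - 0) < e"
      using M.nonneg[OF fX[OF x] fX[OF sX]] by auto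
  qed
  then show ?thesis
    using x sX fX by (auto simp: forward_convergent_def)
qed

end

section \<open>The real line as a target, and extension from closed discrete sets\<close>

lemma quasi_metric_space_abs: "quasi_metric_space (UNIV :: real set) (\<lambda>s t. \<bar>s - t\<bar>)"
  by unfold_locales auto

lemma forward_topology_abs: "forward_topology (UNIV :: real set) (\<lambda>s t. \<bar>s - t\<bar>) = euclideanreal"
proof -
  interpret R: quasi_metric_space "UNIV :: real set" "\<lambda>s t. \<bar>s - t\<bar>"
    by (fact quasi_metric_space_abs)
  have "forward_ball UNIV (\<lambda>s t. \<bar>s - t\<bar>) x e = ball x e" for x e :: real
    by (auto simp: forward_ball_def dist_real_def)
  then show ?thesis
    by (simp add: topology_eq R.openin_forward_topology_iff open_contains_ball)
qed

lemma forward_imp_backward_abs: "forward_imp_backward (UNIV :: real set) (\<lambda>s t. \<bar>s - t\<bar>)"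
  by (simp add: forward_imp_backward_def forward_convergent_def backward_convergent_def
      abs_minus_commute)

text \<open>This closes the cycle of implications: the distance on the reals is symmetric, so they
  are an admissible target in (d).\<close>

lemma UC_space_if_forward_continuous_imp_uniform:
  "forward_continuous_imp_uniform X d TYPE(real) \<Longrightarrow> UC_space X d"
  using quasi_metric_space_abs forward_imp_backward_abs
  unfolding UC_space_def forward_continuous_imp_uniform_def by blast

lemma UC_spaceD:
  assumes "UC_space X d" "continuous_map (forward_topology X d) euclideanreal f" "\<epsilon> > 0"
  obtains \<delta> where "\<delta> > 0" "\<And>x y. x \<in> X \<Longrightarrow> y \<in> X \<Longrightarrow> d x y < \<delta> \<Longrightarrow> \<bar>f x - f y\<bar> < \<epsilon>"
proof -
  have "forward_uniformly_continuous X d UNIV (\<lambda>s t. \<bar>s - t\<bar>) f"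
    using assms(1,2) by (simp add: UC_space_def forward_continuous_def forward_topology_abs)
  then have "\<exists>\<delta>>0. \<forall>x\<in>X. \<forall>y\<in>X. d x y < \<delta> \<longrightarrow> \<bar>f x - f y\<bar> < \<epsilon>"
    using assms(3) by (simp add: forward_uniformly_continuous_def)
  with that show thesis by meson
qed

text \<open>A set without accumulation points is closed and discrete as a subspace, so every real
  function on it is continuous and Tietze applies. Taking \<open>UNIV\<close> as the interval allows
  unbounded \<open>f\<close>.\<close>

lemma normal_space_extend_from_closed_discrete:
  fixes f :: "'a \<Rightarrow> real"
  assumes "normal_space \<tau>" "\<tau> derived_set_of T = {}" "T \<subseteq> topspace \<tau>"
  obtains g where "continuous_map \<tau> euclideanreal g" "\<And>x. x \<in> T \<Longrightarrow> g x = f x"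
proof -
  have "subtopology \<tau> T = discrete_topology T"
    using assms by (simp add: subtopology_eq_discrete_topology_eq)
  then have "continuous_map (subtopology \<tau> T) euclideanreal f"
    by simp
  moreover have "closedin \<tau> T"
    using assms by (simp add: closedin_contains_derived_set)
  ultimately show thesis
    using Tietze_extension_realinterval[of \<tau> T UNIV f] assms(1) that by auto
qed

section \<open>From uniform continuity to condition (b)\<close>

context quasi_metric_space
begin

lemma UC_space_imp_finite_nonisolated:
  assumes t1: "t1_space (forward_topology X d)" and normal: "normal_space (forward_topology X d)"
    and UC: "UC_space X d"
    and A: "A \<subseteq> X" "forward_topology X d derived_set_of A = {}"
  shows "finite (A \<inter> nonisolated_points X d)"
proof (rule ccontr)
  let ?\<tau> = "forward_topology X d"
  assume "infinite (A \<inter> nonisolated_points X d)"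
  then obtain a :: "nat \<Rightarrow> 'a"
    where a: "inj a" "range a \<subseteq> A \<inter> nonisolated_points X d"
    by (meson infinite_countable_subset)
  have aX: "a n \<in> X" for n using a(2) A(1) by blast
  have "?\<tau> derived_set_of range a \<subseteq> ?\<tau> derived_set_of A"
    using a(2) by (intro derived_set_of_mono) auto
  then have "?\<tau> derived_set_of range a = {}"
    using A(2) by simp
  \<comment> \<open>The prescribed value is the index itself: \<open>the_inv a\<close> recovers
    \<open>n\<close> from the point \<open>a n\<close>.\<close>
  with normal obtain g where g: "continuous_map ?\<tau> euclideanreal g"
      and "\<And>x. x \<in> range a \<Longrightarrow> g x = real (the_inv a x)"
    by (rule normal_space_extend_from_closed_discrete[where T = "range a"
            and f = "\<lambda>x. real (the_inv a x)"])
      (use aX in \<open>auto simp: topspace_forward_topology\<close>)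
  then have ga: "g (a n) = real n" for n
    using a(1) by (simp add: the_inv_f_f)
  have nbhd: "openin ?\<tau> {x \<in> X. \<bar>g x - c\<bar> < e}" for c e
  proof -
    have "openin ?\<tau> {x \<in> topspace ?\<tau>. g x \<in> ball c e}"
      by (rule openin_continuous_map_preimage[OF g]) simp
    then show ?thesis
      by (simp add: topspace_forward_topology dist_real_def abs_minus_commute)
  qed
  \<comment> \<open>Non-isolation is applied to a ball intersected with the strip where
    \<open>g\<close> is within 1/3 of \<open>n\<close>. The strip records the index of
    \<open>b n\<close> in the value of \<open>g\<close>, up to an error too small to confuse two
    integers.\<close>
  have "\<exists>b. b \<in> X \<and> b \<noteq> a n \<and> d (a n) b < inverse (real (Suc n)) \<and> \<bar>g b - real n\<bar> < 1/3" for n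
  proof -
    let ?e = "inverse (real (Suc n))"
    let ?U = "forward_ball X d (a n) ?e \<inter> {x \<in> X. \<bar>g x - real n\<bar> < 1/3}"
    have "openin ?\<tau> ?U"
      by (intro openin_Int nbhd openin_forward_ball aX) simp
    moreover have "a n \<in> ?U"
      using aX ga by (simp add: centre_in_forward_ball)
    moreover have "a n \<in> nonisolated_points X d"
      using a(2) by blast
    ultimately obtain b where "b \<in> ?U" "b \<noteq> a n"
      using nonisolatedE by blast
    then show ?thesis by (auto simp: forward_ball_def)
  qed
  then obtain b where b: "\<And>n. b n \<in> X" "\<And>n. b n \<noteq> a n"
      "\<And>n. d (a n) (b n) < inverse (real (Suc n))" "\<And>n. \<bar>g (b n) - real n\<bar> < 1/3"
    by metis
  \<comment> \<open>This is needed for all pairs of indices, so that the indicator of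
    \<open>range b\<close> vanishes at every \<open>a m\<close>.\<close>
  have ab: "a m \<noteq> b n" for m n
  proof
    assume eq: "a m = b n"
    then have "\<bar>real m - real n\<bar> < 1/3"
      using b(4)[of n] ga[of m] by simp
    then have "m = n" by linarith
    with eq b(2) show False by metis
  qed
  let ?T = "range a \<union> range b"
  have "?\<tau> derived_set_of ?T = {}"
  proof (rule equals0I)
    fix x assume x: "x \<in> ?\<tau> derived_set_of ?T"
    then have xX: "x \<in> X"
      by (simp add: in_derived_set_of topspace_forward_topology)
    \<comment> \<open>A point of \<open>?T\<close> in \<open>?U\<close> has an index
      \<open>n\<close> within 1/3 + 1/3 of \<open>g x\<close>, hence below \<open>g x + 1\<close>.
      Only finitely many naturals are that small, so \<open>?U\<close> meets \<open>?T\<close> in a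
      finite set.\<close>
    let ?U = "{y \<in> X. \<bar>g y - g x\<bar> < 1/3}" and ?N = "{n. real n < g x + 1}"
    have "?N \<subseteq> {..nat \<lceil>g x + 1\<rceil>}"
      by (auto simp: le_nat_iff) linarith
    then have "finite ?N"
      by (rule finite_subset) simp
    moreover have "?T \<inter> ?U \<subseteq> a ` ?N \<union> b ` ?N"
    proof
      fix y assume y: "y \<in> ?T \<inter> ?U"
      then obtain n where n: "y = a n \<or> y = b n" by blast
      then have "\<bar>g y - real n\<bar> < 1/3"
        using b(4)[of n] ga[of n] by auto
      moreover have "\<bar>g y - g x\<bar> < 1/3" using y by blast
      ultimately have "n \<in> ?N" unfolding mem_Collect_eq by linarith
      with n show "y \<in> a ` ?N \<union> b ` ?N" by blast
    qed
    ultimately have "finite (?T \<inter> ?U)"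
      by (meson finite_UnI finite_imageI finite_subset)
    then show False
      using t1_space_derived_set_of_infinite_Int[OF t1 x nbhd[of "g x" "1/3"]] xX by simp
  qed
  \<comment> \<open>\<open>h\<close> is 0 at every \<open>a n\<close> and 1 at every
    \<open>b n\<close>, while the distances from \<open>a n\<close> to \<open>b n\<close> tend to
    0.\<close>
  with normal obtain h where h: "continuous_map ?\<tau> euclideanreal h"
      and hT: "\<And>x. x \<in> ?T \<Longrightarrow> h x = indicator (range b) x"
    by (rule normal_space_extend_from_closed_discrete[where T = ?T and f = "indicator (range b)"])
      (use aX b(1) in \<open>auto simp: topspace_forward_topology\<close>)
  obtain \<delta> where "\<delta> > 0"
      and \<delta>: "\<And>x y. x \<in> X \<Longrightarrow> y \<in> X \<Longrightarrow> d x y < \<delta> \<Longrightarrow> \<bar>h x - h y\<bar> < 1"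
    using UC_spaceD[OF UC h zero_less_one] by blast
  then obtain n where "inverse (real (Suc n)) < \<delta>"
    using reals_Archimedean by blast
  then have "\<bar>h (a n) - h (b n)\<bar> < 1"
    using b(3)[of n] by (intro \<delta> aX b(1)) simp
  moreover have "h (a n) = 0" "h (b n) = 1"
    using ab hT by (auto simp: indicator_def)
  ultimately show False by simp
qed

lemma UC_space_imp_isolation_bounded_below:
  assumes UC: "UC_space X d"
    and A: "A \<subseteq> X" "forward_topology X d derived_set_of A = {}"
  shows "(INF x \<in> A - nonisolated_points X d. isolation X d x) > 0"
proof (rule ccontr)
  let ?\<tau> = "forward_topology X d"
  assume "\<not> ?thesis"
  then have "(INF x \<in> A - nonisolated_points X d. isolation X d x) < ereal e" if "e > 0" for e
    using that by (metis ereal_less(2) le_less_trans not_le)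
  then have "\<exists>x \<in> A - nonisolated_points X d. \<exists>y\<in>X - {x}. d x y < e" if "e > 0" for e
    using that by (simp add: INF_less_iff isolation_less_iff)
  then have "\<forall>n. \<exists>x y. x \<in> A - nonisolated_points X d \<and> y \<in> X \<and> y \<noteq> x \<and>
      d x y < inverse (real (Suc n))"
    by (metis DiffE inverse_positive_iff_positive of_nat_0_less_iff singletonI zero_less_Suc)
  then obtain a b where a: "\<And>n. a n \<in> A - nonisolated_points X d"
      and b: "\<And>n. b n \<in> X" "\<And>n. b n \<noteq> a n" "\<And>n. d (a n) (b n) < inverse (real (Suc n))"
    by metis
  let ?S = "range a"
  \<comment> \<open>\<open>Suc\<close> keeps the values on \<open>?S\<close> at 1 or more, away from
    the value 0 outside. So \<open>f (a n)\<close> and \<open>f (b n)\<close> differ by at least 1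
    whether or not \<open>b n\<close> lies in \<open>?S\<close>; \<open>to_nat_on\<close> serves
    finite and infinite ranges alike.\<close>
  define f where "f x = (if x \<in> ?S then real (Suc (to_nat_on ?S x)) else 0)" for x
  have "?\<tau> derived_set_of ?S \<subseteq> ?\<tau> derived_set_of A"
    using a by (intro derived_set_of_mono) auto
  then have "closedin ?\<tau> ?S"
    using A a by (auto simp: closedin_contains_derived_set topspace_forward_topology)
  then have co: "openin ?\<tau> (X - ?S)"
    using openin_diff[OF openin_topspace] by (metis topspace_forward_topology)
  have aX: "a n \<in> X" for n using a A(1) by blast
  have single: "openin ?\<tau> {x}" if "x \<in> ?S" for x
    using that a aX by (auto simp: nonisolated_points_def isolated_points_def)
  \<comment> \<open>Every point has an open neighbourhood on which \<open>f\<close> is constant: its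
    singleton if it lies in \<open>?S\<close>, and otherwise the complement of
    \<open>?S\<close>.\<close>
  have "continuous_map ?\<tau> euclideanreal f"
    unfolding continuous_map_def
  proof (intro conjI allI impI)
    fix U :: "real set"
    show "openin ?\<tau> {x \<in> topspace ?\<tau>. f x \<in> U}"
    proof (subst openin_subopen, intro ballI)
      fix x assume x: "x \<in> {x \<in> topspace ?\<tau>. f x \<in> U}"
      show "\<exists>V. openin ?\<tau> V \<and> x \<in> V \<and> V \<subseteq> {x \<in> topspace ?\<tau>. f x \<in> U}"
      proof (cases "x \<in> ?S")
        case True
        with x single show ?thesis by blast
      next
        case False
        with x have "x \<in> X - ?S" "X - ?S \<subseteq> {x \<in> topspace ?\<tau>. f x \<in> U}"
          by (auto simp: f_def topspace_forward_topology)
        with co show ?thesis by blast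
      qed
    qed
  qed auto
  then obtain \<delta> where "\<delta> > 0"
      and \<delta>: "\<And>x y. x \<in> X \<Longrightarrow> y \<in> X \<Longrightarrow> d x y < \<delta> \<Longrightarrow> \<bar>f x - f y\<bar> < 1"
    using UC_spaceD[OF UC _ zero_less_one] by blast
  then obtain n where "inverse (real (Suc n)) < \<delta>"
    using reals_Archimedean by blast
  then have close: "\<bar>f (a n) - f (b n)\<bar> < 1"
    using b(3)[of n] by (intro \<delta> aX b(1)) simp
  show False
  proof (cases "b n \<in> ?S")
    case True
    then have "to_nat_on ?S (a n) \<noteq> to_nat_on ?S (b n)"
      using b(2)[of n] inj_on_to_nat_on[of ?S] by (auto dest: inj_onD)
    moreover have "\<bar>real (to_nat_on ?S (a n)) - real (to_nat_on ?S (b n))\<bar> < 1"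
      using True close by (simp add: f_def)
    ultimately show False by linarith
  next
    case False
    with close show False by (simp add: f_def)
  qed
qed

section \<open>From (b) to (c), and from (c) to (d)\<close>

lemma sequence_condition_if_set_condition:
  assumes t1: "t1_space (forward_topology X d)"
    and b: "\<And>A. A \<subseteq> X \<Longrightarrow> forward_topology X d derived_set_of A = {} \<Longrightarrow>
           finite (A \<inter> nonisolated_points X d) \<and>
           (INF x \<in> A - nonisolated_points X d. isolation X d x) > 0"
    and s: "range s \<subseteq> X" and no: "\<nexists>x. cluster_point X d s x"
  shows "finite {n. s n \<notin> isolated_points X d}"
    and "(INF n \<in> - {n. s n \<notin> isolated_points X d}. isolation X d (s n)) > 0"
proof -
  let ?B = "{n. s n \<notin> isolated_points X d}"
  have fin: "finite (range s \<inter> nonisolated_points X d)"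
    and pos: "(INF x \<in> range s - nonisolated_points X d. isolation X d x) > 0"
    using b[OF s derived_set_of_range_empty[OF t1 s no]] by auto
  show "finite ?B"
  proof (rule ccontr)
    assume inf: "infinite ?B"
    have "s ` ?B \<subseteq> range s \<inter> nonisolated_points X d"
      using s by (auto simp: nonisolated_points_def)
    then have "finite (s ` ?B)"
      using fin by (rule finite_subset)
    \<comment> \<open>Infinitely many indices share finitely many values, so one value recurs
      infinitely often and is itself a cluster point.\<close>
    from pigeonhole_infinite[OF inf this] obtain m where m: "infinite {n \<in> ?B. s n = s m}"
      by blast
    have "cluster_point X d s (s m)"
    proof (rule cluster_pointI[OF s])
      show "s m \<in> X" using s by blast
      fix e :: real assume "e > 0"
      then have "{n \<in> ?B. s n = s m} \<subseteq> {n. d (s m) (s n) < e}"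
        using s by (auto simp: refl_zero image_subset_iff)
      with m show "infinite {n. d (s m) (s n) < e}"
        using finite_subset by blast
    qed
    with no show False by blast
  qed
  \<comment> \<open>Each term with index outside \<open>?B\<close> is an isolated point of the
    range, so the infimum over indices runs over values already bounded below.\<close>
  have "(INF x \<in> range s - nonisolated_points X d. isolation X d x)
      \<le> (INF n \<in> - ?B. isolation X d (s n))"
    by (rule INF_mono) (auto simp: nonisolated_points_def)
  with pos show "(INF n \<in> - ?B. isolation X d (s n)) > 0"
    by (rule less_le_trans)
qed

lemma forward_uniformly_continuous_if_sequence_condition:
  assumes c: "\<And>s :: nat \<Rightarrow> 'a. range s \<subseteq> X \<Longrightarrow> \<nexists>x. cluster_point X d s x \<Longrightarrow>
        finite {n. s n \<notin> isolated_points X d} \<and>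
        (INF n \<in> - {n. s n \<notin> isolated_points X d}. isolation X d (s n)) > 0"
    and M: "quasi_metric_space M \<rho>" and fb: "forward_imp_backward M \<rho>"
    and f: "forward_continuous X d M \<rho> f"
  shows "forward_uniformly_continuous X d M \<rho> f"
proof -
  interpret M: quasi_metric_space M \<rho> by (fact M)
  have fX: "\<And>y. y \<in> X \<Longrightarrow> f y \<in> M"
    using continuous_map_funspace[OF f[unfolded forward_continuous_def]]
    by (auto simp: topspace_forward_topology M.topspace_forward_topology)
  show ?thesis
  proof (rule ccontr)
    assume "\<not> ?thesis"
    moreover have "f ` X \<subseteq> M" using fX by blast
    ultimately have "\<not> (\<forall>e>0. \<exists>\<delta>>0. \<forall>x\<in>X. \<forall>y\<in>X. d x y < \<delta> \<longrightarrow> \<rho> (f x) (f y) < e)"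
      unfolding forward_uniformly_continuous_def by simp
    then obtain e where e: "e > 0"
        and bad: "\<And>\<delta>. \<delta> > 0 \<Longrightarrow> \<exists>x\<in>X. \<exists>y\<in>X. d x y < \<delta> \<and> \<not> \<rho> (f x) (f y) < e"
      by meson
    have "\<forall>n. \<exists>x y. x \<in> X \<and> y \<in> X \<and> d x y < inverse (real (Suc n)) \<and> e \<le> \<rho> (f x) (f y)"
    proof
      fix n
      show "\<exists>x y. x \<in> X \<and> y \<in> X \<and> d x y < inverse (real (Suc n)) \<and> e \<le> \<rho> (f x) (f y)"
        using bad[of "inverse (real (Suc n))"] by (auto simp: not_less)
    qed
    then obtain x y where x: "\<And>n. x n \<in> X" and y: "\<And>n. y n \<in> X"
        and xy: "\<And>n. d (x n) (y n) < inverse (real (Suc n))"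
        and far: "\<And>n. e \<le> \<rho> (f (x n)) (f (y n))"
      by metis
    have lim: "(\<lambda>n. d (x n) (y n)) \<longlonglongrightarrow> 0"
      by (rule tendsto_sandwich[OF _ _ tendsto_const LIMSEQ_inverse_real_of_nat])
        (use x y xy nonneg in \<open>auto intro!: always_eventually less_imp_le\<close>)
    show False
    proof (cases "\<exists>z. cluster_point X d x z")
      case True
      then obtain z r where r: "strict_mono r" and xz: "forward_convergent X d (x \<circ> r) z"
        unfolding cluster_point_def by blast
      then have z: "z \<in> X" by (simp add: forward_convergent_def)
      \<comment> \<open>The triangle inequality through \<open>x (r n)\<close> uses both distances
        in the available direction, so \<open>y\<close> follows \<open>x\<close> to \<open>z\<close>
        without symmetry.\<close>
      have "(\<lambda>n. d z (y (r n))) \<longlonglongrightarrow> 0"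
      proof (rule tendsto_sandwich[OF _ _ tendsto_const])
        show "(\<lambda>n. d z (x (r n)) + d (x (r n)) (y (r n))) \<longlonglongrightarrow> 0"
          using tendsto_add[OF _ LIMSEQ_subseq_LIMSEQ[OF lim r]] xz
          by (fastforce simp: forward_convergent_def o_def)
      qed (use z x y nonneg triangle in \<open>auto intro!: always_eventually\<close>)
      then have "forward_convergent X d (y \<circ> r) z"
        using z y by (auto simp: forward_convergent_def)
      then have fy: "(\<lambda>n. \<rho> (f z) (f (y (r n)))) \<longlonglongrightarrow> 0"
        using forward_convergent_image[OF M f] by (force simp: forward_convergent_def)
      \<comment> \<open>The path from \<open>f (x (r n))\<close> to \<open>f (y (r n))\<close>
        through \<open>f z\<close> enters \<open>f z\<close> and then leaves it. Continuity controls
        the second leg; the first is where the assumption on the target enters.\<close>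
      have "backward_convergent M \<rho> (f \<circ> (x \<circ> r)) (f z)"
        using forward_convergent_image[OF M f xz] fb by (simp add: forward_imp_backward_def)
      then have "(\<lambda>n. \<rho> (f (x (r n))) (f z)) \<longlonglongrightarrow> 0"
        by (simp add: backward_convergent_def)
      from tendsto_add[OF this fy]
      have "(\<lambda>n. \<rho> (f (x (r n))) (f z) + \<rho> (f z) (f (y (r n)))) \<longlonglongrightarrow> 0" by simp
      moreover have "e \<le> \<rho> (f (x (r n))) (f z) + \<rho> (f z) (f (y (r n)))" for n
        using far[of "r n"] M.triangle[OF fX[OF x] fX[OF y] fX[OF z]] by (meson order_trans)
      ultimately have "e \<le> 0"
        by (intro LIMSEQ_le_const) auto
      with e show False by simp
    next
      case False
      let ?B = "{n. x n \<notin> isolated_points X d}"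
      have fin: "finite ?B" and "(INF n \<in> - ?B. isolation X d (x n)) > 0"
        using c[of x] False x by auto
      \<comment> \<open>The infimum is an extended real; density supplies a real bound strictly
        between 0 and it, to compare with \<open>d\<close>.\<close>
      then obtain \<delta> where \<delta>: "0 < ereal \<delta>" "ereal \<delta> < (INF n \<in> - ?B. isolation X d (x n))"
        using ereal_dense2 by blast
      have "\<forall>\<^sub>F n in sequentially. n \<notin> ?B"
        using fin by (simp add: eventually_cofinite flip: cofinite_eq_sequentially)
      moreover have "\<forall>\<^sub>F n in sequentially. d (x n) (y n) < \<delta>"
        using lim \<delta>(1) by (intro order_tendstoD(2)) auto
      ultimately have "\<forall>\<^sub>F n in sequentially. n \<notin> ?B \<and> d (x n) (y n) < \<delta>"
        by (rule eventually_conj)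
      then obtain n where n: "n \<notin> ?B" "d (x n) (y n) < \<delta>"
        using eventually_happens'[OF sequentially_bot] by blast
      \<comment> \<open>The images are at least \<open>e\<close> apart, so the points differ and
        \<open>y n\<close> competes in the infimum defining the isolation of
        \<open>x n\<close>.\<close>
      have "y n \<noteq> x n"
        using far[of n] e M.refl_zero[OF fX[OF x[of n]]] by auto
      then have "isolation X d (x n) < ereal \<delta>"
        using n(2) y[of n] by (auto simp: isolation_less_iff)
      moreover have "(INF n \<in> - ?B. isolation X d (x n)) \<le> isolation X d (x n)"
        using n(1) by (intro INF_lower) simp
      ultimately show False
        using \<delta>(2) by simp
    qed
  qed
qed

end

theorem theorem4p13:
  fixes X :: "'a set" and d :: "'a \<Rightarrow> 'a \<Rightarrow> real"
  assumes "quasi_metric_space X d"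
    and "t1_space (forward_topology X d)"
    and "normal_space (forward_topology X d)"
  shows
    "(UC_space X d \<longleftrightarrow>
        (\<forall>A \<subseteq> X. forward_topology X d derived_set_of A = {} \<longrightarrow>
           finite (A \<inter> nonisolated_points X d) \<and>
           (INF x \<in> A - nonisolated_points X d. isolation X d x) > 0)) \<and>
     (UC_space X d \<longleftrightarrow>
        (\<forall>s :: nat \<Rightarrow> 'a. range s \<subseteq> X \<longrightarrow> (\<nexists>x. cluster_point X d s x) \<longrightarrow>
           (let B = {n. s n \<notin> isolated_points X d}
            in finite B \<and> (INF n \<in> - B. isolation X d (s n)) > 0))) \<and>
     (UC_space X d \<longleftrightarrow>
        forward_continuous_imp_uniform X d TYPE('m) \<and>
        forward_continuous_imp_uniform X d TYPE(real))"
    (is "(_ \<longleftrightarrow> ?b) \<and> (_ \<longleftrightarrow> ?c) \<and> (_ \<longleftrightarrow> ?dm \<and> ?dr)")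
proof -
  interpret quasi_metric_space X d by (fact assms(1))
  have ab: "UC_space X d \<Longrightarrow> ?b"
    using UC_space_imp_finite_nonisolated[OF assms(2,3)] UC_space_imp_isolation_bounded_below
    by blast
  have bc: "?b \<Longrightarrow> ?c"
    unfolding Let_def using sequence_condition_if_set_condition[OF assms(2)] by simp
  have cdm: "?c \<Longrightarrow> ?dm" and cdr: "?c \<Longrightarrow> ?dr"
    unfolding Let_def forward_continuous_imp_uniform_def
    using forward_uniformly_continuous_if_sequence_condition by blast+
  \<comment> \<open>Condition (c) yields (d) for both target types, and the instance
    \<open>real\<close> leads back to (a).\<close>
  from ab bc cdm cdr UC_space_if_forward_continuous_imp_uniform show ?thesis
    by blast
qed

end
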